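(* Let $\Omega\subseteq\mathbb{R}^d$ and $f\colon\Omega\to\overline{\mathbb{R}}$. Let the set $\Omega^{\circ}\subseteq\Omega$ be closed in $\Omega$ (in the induced topology), and let $f^{\circ}\colon\Omega^{\circ}\to\overline{\mathbb{R}}$ be defined by $f^{\circ}(x)=f(x)$ for $x\in\Omega^{\circ}\setminus\partial_{\Omega}\Omega^{\circ}$ and $f^{\circ}(x)=\mathcal{B}_{f,\Omega}(x)$ for $x\in\partial_{\Omega}\Omega^{\circ}$. Then $\mathcal{B}_{f,\Omega}|_{\Omega^{\circ}}=\mathcal{B}_{f^{\circ},\Omega^{\circ}}$.
   Context: $\overline{\mathbb{R}}=\mathbb{R}\cup\{-\infty,+\infty\}$. An $\overline{\mathbb{R}}$-valued function $B$ on a convex set is concave if its subgraph $\{(z,t):t\in\mathbb{R},\,t\le B(z)\}$ is convex. A function $B\colon\Omega\to\overline{\mathbb{R}}$ is locally concave if its restriction to every segment contained in $\Omega$ is concave. The minimal locally concave function on $\Omega$ with obstacle $f\colon\Omega\to\overline{\mathbb{R}}$ is $\mathcal{B}_{f,\Omega}(x)=\inf\{B(x): B\colon\Omega\to\overline{\mathbb{R}}\text{ locally concave},\ B\ge f\}$, $x\in\Omega$. $\partial_{\Omega}\Omega^{\circ}$ denotes the boundary of $\Omega^{\circ}$ in the topology induced on $\Omega$ from $\mathbb{R}^d$. *)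

theory Defs
  imports "HOL-Analysis.Analysis"
begin

definition subgraph :: "'a set \<Rightarrow> ('a \<Rightarrow> ereal) \<Rightarrow> ('a \<times> real) set" where
  "subgraph S B = {(z, t). z \<in> S \<and> ereal t \<le> B z}"

(* The height t in the subgraph is real, so both infinite values are allowed for B
   and no arithmetic on ereal is needed. *)
definition ereal_concave_on :: "'a::real_vector set \<Rightarrow> ('a \<Rightarrow> ereal) \<Rightarrow> bool" where
  "ereal_concave_on S B \<longleftrightarrow> convex S \<and> convex (subgraph S B)"

definition locally_concave_on :: "'a::real_vector set \<Rightarrow> ('a \<Rightarrow> ereal) \<Rightarrow> bool" where
  "locally_concave_on \<Omega> B \<longleftrightarrow>
     (\<forall>a b. closed_segment a b \<subseteq> \<Omega> \<longrightarrow> ereal_concave_on (closed_segment a b) B)"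

(* Functions on \<Omega> are represented by total functions; the conditions on the competitors B
   involve only their values on \<Omega>, and the value of this function is meaningful only for
   x in \<Omega>. *)
definition min_locally_concave ::
    "('a::real_vector \<Rightarrow> ereal) \<Rightarrow> 'a set \<Rightarrow> 'a \<Rightarrow> ereal" where
  "min_locally_concave f \<Omega> x =
     Inf {B x | B. locally_concave_on \<Omega> B \<and> (\<forall>y\<in>\<Omega>. f y \<le> B y)}"

end

theory Submission
  imports Defs
begin

text \<open>
  Write \<open>B\<close> for the minimal locally concave function on \<open>\<Omega>\<close> with obstacle \<open>f\<close>. An infimum of
  locally concave functions is locally concave, so \<open>B\<close> itself is a competitor in both extremal
  problems: on \<open>\<Omega>0\<close> it majorizes \<open>f0\<close>, which gives one of the two inequalities.

  For the other one, a competitor \<open>G\<close> on \<open>\<Omega>0\<close> is turned into a competitor on \<open>\<Omega>\<close>: take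
  \<open>min G B\<close> on \<open>\<Omega>0\<close> and \<open>B\<close> elsewhere. This majorizes \<open>f\<close>, since on the relative boundary
  \<open>G \<ge> f0 = B \<ge> f\<close>, and it is locally concave by a gluing argument
  (\<open>locally_concave_on_glue_min\<close>). A chord of the glued function lies below \<open>B\<close>, hence below the
  glued function wherever the latter equals \<open>B\<close>. Around any other point the chord is cut, on
  each side, at the nearest point over the relative boundary of \<open>\<Omega>0\<close>; a side without such a
  point is kept whole. Over the relative boundary \<open>min G B = B\<close>, so the shortened chord again
  has its end points in the subgraph, and now it projects into \<open>\<Omega>0\<close>, where \<open>min G B\<close> is
  locally concave.

  All chords are treated as segments in the graph space, that is, as segments whose end points
  are in the subgraph; infinite values then need no separate discussion.
\<close>

section \<open>Local concavity in terms of chords\<close>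

lemma subgraph_iff: "P \<in> subgraph S B \<longleftrightarrow> fst P \<in> S \<and> ereal (snd P) \<le> B (fst P)"
  by (cases P) (simp add: subgraph_def)

lemma fst_closed_segment:
  fixes P Q :: "'a::real_vector \<times> 'b::real_vector"
  shows "fst ` closed_segment P Q = closed_segment (fst P) (fst Q)"
  using closed_segment_linear_image[OF linear_fst, of P Q] by simp

text \<open>
  The restriction to a segment of \<open>\<Omega>\<close> has a convex subgraph iff the subgraph over \<open>\<Omega>\<close> contains
  every chord that projects into that segment, because each such projection is again a segment
  of \<open>\<Omega>\<close>.
\<close>

lemma locally_concave_on_iff_chords:
  "locally_concave_on \<Omega> B \<longleftrightarrow>
     (\<forall>P\<in>subgraph \<Omega> B. \<forall>Q\<in>subgraph \<Omega> B.
        closed_segment (fst P) (fst Q) \<subseteq> \<Omega> \<longrightarrow> closed_segment P Q \<subseteq> subgraph \<Omega> B)"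
proof (intro iffI ballI impI)
  fix P Q
  assume conc: "locally_concave_on \<Omega> B" and PQ: "P \<in> subgraph \<Omega> B" "Q \<in> subgraph \<Omega> B"
    and sub: "closed_segment (fst P) (fst Q) \<subseteq> \<Omega>"
  let ?S = "closed_segment (fst P) (fst Q)"
  have "convex (subgraph ?S B)"
    using conc sub by (simp add: locally_concave_on_def ereal_concave_on_def)
  moreover have "P \<in> subgraph ?S B" "Q \<in> subgraph ?S B"
    using PQ by (auto simp: subgraph_iff)
  ultimately have "closed_segment P Q \<subseteq> subgraph ?S B"
    by (rule closed_segment_subset[rotated 2])
  then show "closed_segment P Q \<subseteq> subgraph \<Omega> B"
    using sub by (auto simp: subgraph_def)
next
  assume chords: "\<forall>P\<in>subgraph \<Omega> B. \<forall>Q\<in>subgraph \<Omega> B.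
        closed_segment (fst P) (fst Q) \<subseteq> \<Omega> \<longrightarrow> closed_segment P Q \<subseteq> subgraph \<Omega> B"
  have "closed_segment P Q \<subseteq> subgraph (closed_segment a b) B"
    if ab: "closed_segment a b \<subseteq> \<Omega>"
      and P: "P \<in> subgraph (closed_segment a b) B" and Q: "Q \<in> subgraph (closed_segment a b) B"
    for a b P Q
  proof -
    have sub: "closed_segment (fst P) (fst Q) \<subseteq> closed_segment a b"
      using P Q by (intro closed_segment_subset) (auto simp: subgraph_iff)
    have "P \<in> subgraph \<Omega> B" "Q \<in> subgraph \<Omega> B"
      using P Q ab by (auto simp: subgraph_iff)
    then have "closed_segment P Q \<subseteq> subgraph \<Omega> B"
      using chords ab sub by blast
    moreover have "fst ` closed_segment P Q \<subseteq> closed_segment a b"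
      using sub by (simp add: fst_closed_segment)
    ultimately show ?thesis
      by (fastforce simp: subgraph_iff)
  qed
  then have "convex (subgraph (closed_segment a b) B)" if "closed_segment a b \<subseteq> \<Omega>" for a b
    using that by (simp add: convex_contains_segment)
  then show "locally_concave_on \<Omega> B"
    by (simp add: locally_concave_on_def ereal_concave_on_def)
qed

lemma locally_concave_onD:
  assumes "locally_concave_on \<Omega> B" "P \<in> subgraph \<Omega> B" "Q \<in> subgraph \<Omega> B"
    and "closed_segment (fst P) (fst Q) \<subseteq> \<Omega>"
  shows "closed_segment P Q \<subseteq> subgraph \<Omega> B"
  using assms by (simp add: locally_concave_on_iff_chords)

lemma locally_concave_on_subset:
  assumes "locally_concave_on \<Omega> B" "S \<subseteq> \<Omega>"
  shows "locally_concave_on S B"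
  using assms by (auto simp: locally_concave_on_def)

lemma locally_concave_on_Inf:
  assumes "\<And>B. B \<in> \<B> \<Longrightarrow> locally_concave_on \<Omega> B"
  shows "locally_concave_on \<Omega> (\<lambda>x. INF B\<in>\<B>. B x)"
  unfolding locally_concave_on_iff_chords
proof (intro ballI impI subsetI)
  fix P Q R
  assume P: "P \<in> subgraph \<Omega> (\<lambda>x. INF B\<in>\<B>. B x)" and Q: "Q \<in> subgraph \<Omega> (\<lambda>x. INF B\<in>\<B>. B x)"
    and sub: "closed_segment (fst P) (fst Q) \<subseteq> \<Omega>" and R: "R \<in> closed_segment P Q"
  have "R \<in> subgraph \<Omega> B" if "B \<in> \<B>" for B
    using locally_concave_onD[OF assms[OF that], of P Q] P Q sub R that
    by (auto simp: subgraph_iff le_INF_iff)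
  moreover have "fst R \<in> \<Omega>"
    using R sub by (auto simp flip: fst_closed_segment)
  ultimately show "R \<in> subgraph \<Omega> (\<lambda>x. INF B\<in>\<B>. B x)"
    by (auto simp: subgraph_iff le_INF_iff)
qed

lemma locally_concave_on_min:
  assumes "locally_concave_on \<Omega> G" "locally_concave_on \<Omega> B"
  shows "locally_concave_on \<Omega> (\<lambda>x. min (G x) (B x))"
  using locally_concave_on_Inf[of "{G, B}" \<Omega>] assms by (auto simp: inf_min)

section \<open>Minimal locally concave majorants\<close>

lemma min_locally_concave_eq_INF:
  "min_locally_concave f \<Omega> =
     (\<lambda>x. INF B\<in>{B. locally_concave_on \<Omega> B \<and> (\<forall>y\<in>\<Omega>. f y \<le> B y)}. B x)"
  by (auto simp: fun_eq_iff min_locally_concave_def intro!: arg_cong[of _ _ Inf])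

lemma locally_concave_on_min_locally_concave:
  "locally_concave_on \<Omega> (min_locally_concave f \<Omega>)"
  unfolding min_locally_concave_eq_INF by (rule locally_concave_on_Inf) simp

lemma le_min_locally_concave:
  assumes "x \<in> \<Omega>"
  shows "f x \<le> min_locally_concave f \<Omega> x"
  using assms by (auto simp: min_locally_concave_def intro: Inf_greatest)

lemma min_locally_concave_le:
  assumes "locally_concave_on \<Omega> B" "\<And>y. y \<in> \<Omega> \<Longrightarrow> f y \<le> B y"
  shows "min_locally_concave f \<Omega> x \<le> B x"
  using assms by (auto simp: min_locally_concave_def intro: Inf_lower)

section \<open>Gluing along a relatively closed set\<close>

text \<open>
  The cut point is the point of \<open>F\<close> on the segment that is nearest to \<open>u\<close>, or the far end \<open>a\<close> if
  there is none. All points strictly between it and \<open>u\<close> are outside \<open>F\<close>, hence in \<open>K\<close>, and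
  closedness of \<open>K\<close> adds the cut point itself.
\<close>

lemma closed_segment_exit_point:
  fixes a u :: "'a::euclidean_space"
  assumes K: "closed K" and F: "closed F" and cover: "closed_segment a u \<subseteq> K \<union> F"
    and u: "u \<in> K"
  obtains x where "x \<in> closed_segment a u" "closed_segment x u \<subseteq> K" "x = a \<or> x \<in> F"
proof (cases "closed_segment a u \<inter> F = {}")
  case True
  then show ?thesis
    using cover that[of a] by auto
next
  case False
  have "closed (closed_segment a u \<inter> F)"
    using F by (intro closed_Int) auto
  then obtain x where x: "x \<in> closed_segment a u \<inter> F"
    and nearest: "\<And>y. y \<in> closed_segment a u \<inter> F \<Longrightarrow> dist u x \<le> dist u y"
    using distance_attains_inf[OF _ False, of u] by metis
  have xu: "closed_segment x u \<subseteq> closed_segment a u"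
    using x by (auto simp: subset_closed_segment)
  have "open_segment x u \<subseteq> K"
  proof
    fix y assume y: "y \<in> open_segment x u"
    then have "dist u y < dist u x"
      using dist_in_open_segment[OF y] by (simp add: dist_commute)
    moreover have "y \<in> closed_segment a u"
      using y xu open_closed_segment by blast
    ultimately show "y \<in> K"
      using nearest[of y] cover by force
  qed
  then have "closure (open_segment x u) \<subseteq> K"
    using K by (rule closure_minimal)
  then have "closed_segment x u \<subseteq> K"
    using u by (cases "x = u") auto
  then show ?thesis
    using x by (intro that[of x]) auto
qed

text \<open>
  \<open>F\<close> plays the role of the part of \<open>\<Omega>\<close> on which the glued function is known to equal \<open>B\<close>. There
  chords of \<open>B\<close> suffice. For a point \<open>R\<close> of a chord over \<open>\<Omega>0\<close>, the chord is cut on either side of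
  \<open>R\<close> at a point that is an old end point or lies over \<open>\<Omega>0 \<inter> F\<close>, and in both cases in the subgraph.
\<close>

lemma locally_concave_on_glue_min:
  fixes \<Omega> \<Omega>0 F :: "'a::euclidean_space set"
  assumes cl: "closedin (top_of_set \<Omega>) \<Omega>0" "closedin (top_of_set \<Omega>) F"
    and cover: "\<Omega> \<subseteq> \<Omega>0 \<union> F"
    and B: "locally_concave_on \<Omega> B" and G: "locally_concave_on \<Omega>0 G"
    and overlap: "\<And>x. x \<in> \<Omega>0 \<inter> F \<Longrightarrow> B x \<le> G x"
  shows "locally_concave_on \<Omega> (\<lambda>x. if x \<in> \<Omega>0 then min (G x) (B x) else B x)"
    (is "locally_concave_on \<Omega> ?H")
  unfolding locally_concave_on_iff_chords
proof (intro ballI impI subsetI)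
  fix P Q R
  assume P: "P \<in> subgraph \<Omega> ?H" and Q: "Q \<in> subgraph \<Omega> ?H"
    and sub: "closed_segment (fst P) (fst Q) \<subseteq> \<Omega>" and R: "R \<in> closed_segment P Q"
  have sub\<Omega>: "\<Omega>0 \<subseteq> \<Omega>"
    using closedin_subset[OF cl(1)] by simp
  have HB: "?H x = B x" if "x \<in> F" for x
    using overlap that by (auto simp: min_def intro: antisym)
  have PQ_B: "closed_segment P Q \<subseteq> subgraph \<Omega> B"
    using P Q sub by (intro locally_concave_onD[OF B]) (auto simp: subgraph_iff split: if_splits)
  show "R \<in> subgraph \<Omega> ?H"
  proof (cases "fst R \<in> \<Omega>0")
    case False
    then show ?thesis
      using PQ_B R by (auto simp: subgraph_iff)
  next
    case True
    define over where "over C = closed_segment P Q \<inter> fst -` C" for C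
    have closed_over: "closed (over C)" if "closedin (top_of_set \<Omega>) C" for C
      unfolding over_def
    proof (rule closedin_closed_trans[OF continuous_closedin_preimage_gen[OF _ _ that]])
      show "fst \<in> closed_segment P Q \<rightarrow> \<Omega>"
        using sub fst_closed_segment[of P Q] by blast
    qed (auto intro: continuous_intros)
    have PQ_over: "closed_segment P Q \<subseteq> over \<Omega>0 \<union> over F"
      using PQ_B cover by (force simp: over_def subgraph_iff)
    have R_over: "R \<in> over \<Omega>0"
      using True R by (simp add: over_def)
    have cut: "\<exists>X. X \<in> closed_segment E R \<and> closed_segment X R \<subseteq> over \<Omega>0 \<and>
        X \<in> subgraph \<Omega>0 ?H" if E: "E \<in> {P, Q}" for E
    proof -
      have "closed_segment E R \<subseteq> closed_segment P Q"
        using E R by (auto simp: subset_closed_segment)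
      then obtain X where X: "X \<in> closed_segment E R" "closed_segment X R \<subseteq> over \<Omega>0"
        "X = E \<or> X \<in> over F"
        using closed_segment_exit_point[OF closed_over[OF cl(1)] closed_over[OF cl(2)] _ R_over]
          PQ_over by (metis subset_trans)
      have "X \<in> over \<Omega>0"
        using X(2) by auto
      moreover have "X \<in> subgraph \<Omega> ?H"
        using X(3)
      proof
        assume "X = E"
        then show ?thesis
          using E P Q by auto
      next
        assume "X \<in> over F"
        then have "X \<in> subgraph \<Omega> B" "fst X \<in> F"
          using PQ_B by (auto simp: over_def)
        then show ?thesis
          using HB[of "fst X"] by (simp add: subgraph_iff)
      qed
      ultimately show ?thesis
        using X by (intro exI[of _ X]) (auto simp: over_def subgraph_iff)
    qed
    obtain X where X: "X \<in> closed_segment P R" "closed_segment X R \<subseteq> over \<Omega>0"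
      "X \<in> subgraph \<Omega>0 ?H"
      using cut[of P] by auto
    obtain Y where Y: "Y \<in> closed_segment Q R" "closed_segment Y R \<subseteq> over \<Omega>0"
      "Y \<in> subgraph \<Omega>0 ?H"
      using cut[of Q] by auto
    have R_XY: "R \<in> closed_segment X Y"
    proof -
      have "between (Q, X) R"
        using R X(1) between_trans_2[of P Q R X]
        by (simp add: between_mem_segment closed_segment_commute)
      then have "between (X, Y) R"
        using Y(1) between_trans_2[of Q X R Y]
        by (simp add: between_mem_segment closed_segment_commute)
      then show ?thesis
        by (simp add: between_mem_segment)
    qed
    have "closed_segment X Y = closed_segment X R \<union> closed_segment Y R"
      using Un_closed_segment[OF R_XY] by (simp add: closed_segment_commute)
    then have "closed_segment (fst X) (fst Y) \<subseteq> \<Omega>0"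
      using X(2) Y(2) by (auto simp: over_def simp flip: fst_closed_segment)
    moreover have "locally_concave_on \<Omega>0 (\<lambda>x. min (G x) (B x))"
      using G locally_concave_on_subset[OF B sub\<Omega>] by (rule locally_concave_on_min)
    ultimately have "closed_segment X Y \<subseteq> subgraph \<Omega>0 (\<lambda>x. min (G x) (B x))"
      using X(3) Y(3) by (intro locally_concave_onD) (auto simp: subgraph_iff)
    then show ?thesis
      using R_XY sub\<Omega> by (auto simp: subgraph_iff)
  qed
qed

section \<open>Restriction of the minimal locally concave function\<close>

theorem theorem7p4:
  fixes \<Omega> \<Omega>0 :: "(real ^ 'd) set"
    and f f0 :: "real ^ 'd \<Rightarrow> ereal"
  assumes "\<Omega>0 \<subseteq> \<Omega>"
    and "closedin (top_of_set \<Omega>) \<Omega>0"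
    and "\<And>x. x \<in> \<Omega>0 - (top_of_set \<Omega>) frontier_of \<Omega>0 \<Longrightarrow> f0 x = f x"
    and "\<And>x. x \<in> (top_of_set \<Omega>) frontier_of \<Omega>0 \<Longrightarrow> f0 x = min_locally_concave f \<Omega> x"
  shows "\<forall>x\<in>\<Omega>0. min_locally_concave f \<Omega> x = min_locally_concave f0 \<Omega>0 x"
proof (intro ballI antisym)
  fix x assume x: "x \<in> \<Omega>0"
  let ?B = "min_locally_concave f \<Omega>"
  have B: "locally_concave_on \<Omega> ?B"
    by (rule locally_concave_on_min_locally_concave)
  have f_le_B: "f y \<le> ?B y" if "y \<in> \<Omega>" for y
    using that by (rule le_min_locally_concave)
  show "min_locally_concave f0 \<Omega>0 x \<le> ?B x"
  proof (rule min_locally_concave_le)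
    show "locally_concave_on \<Omega>0 ?B"
      using B assms(1) by (rule locally_concave_on_subset)
    show "f0 y \<le> ?B y" if "y \<in> \<Omega>0" for y
      using assms(1,3,4) that f_le_B by (cases "y \<in> (top_of_set \<Omega>) frontier_of \<Omega>0") auto
  qed
  show "?B x \<le> min_locally_concave f0 \<Omega>0 x"
  proof -
    have "?B x \<le> G x" if G: "locally_concave_on \<Omega>0 G" and f0_le: "\<forall>y\<in>\<Omega>0. f0 y \<le> G y" for G
    proof -
      define F where "F = (top_of_set \<Omega>) closure_of (\<Omega> - \<Omega>0)"
      have frontier: "(top_of_set \<Omega>) frontier_of \<Omega>0 = \<Omega>0 \<inter> F"
        using assms(2) by (simp add: F_def frontier_of_closures closure_of_closedin)
      let ?H = "\<lambda>y. if y \<in> \<Omega>0 then min (G y) (?B y) else ?B y"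
      have B_le_G: "?B y \<le> G y" if "y \<in> \<Omega>0 \<inter> F" for y
        using that f0_le assms(4)[of y] frontier by force
      have "\<Omega> - \<Omega>0 \<subseteq> F"
        unfolding F_def by (rule closure_of_subset) auto
      then have "locally_concave_on \<Omega> ?H"
        using assms(2) B G B_le_G
        by (intro locally_concave_on_glue_min[where F = F]) (auto simp: F_def)
      moreover have "f y \<le> ?H y" if "y \<in> \<Omega>" for y
      proof (cases "y \<in> \<Omega>0 - F")
        case True
        then show ?thesis
          using f0_le assms(3)[of y] frontier f_le_B[OF that] by auto
      next
        case False
        then show ?thesis
          using B_le_G[of y] f_le_B[OF that] by (auto intro: order_trans)
      qed
      ultimately have "?B x \<le> ?H x"
        by (rule min_locally_concave_le)
      then show ?thesis
        using x by simp
    qed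
    then show ?thesis
      unfolding min_locally_concave_def[of f0] by (auto intro: Inf_greatest)
  qed
qed

end
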